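(* Let $\mathbf{a},\mathbf{l},\mathbf{u},\mathbf{y}\in\mathbb{R}^n$ with $\mathbf{l}\leqslant\mathbf{u}$ (componentwise), let $b_l,b_u\in\mathbb{R}$, and assume that the set $$\mathcal{D}_{\mathcal{I}}=\{\mathbf{x}\in\mathbb{R}^n:\ \mathbf{l}\leqslant\mathbf{x}\leqslant\mathbf{u},\ b_l\leqslant\mathbf{a}^T\mathbf{x}\leqslant b_u\}$$ is non-empty. Then the quadratic program $$\min\ \tfrac12\,\mathbf{x}^T\mathbf{I}\,\mathbf{x}-\mathbf{y}^T\mathbf{x}\quad\text{subject to}\quad b_l\leqslant\mathbf{a}^T\mathbf{x}\leqslant b_u,\quad \mathbf{l}\leqslant\mathbf{x}\leqslant\mathbf{u}$$ has a unique solution $\mathbf{x}^*$, which is given by $$\mathbf{x}^*=\mathtt{mid}(\mathbf{x}_L^*,\ \mathbf{y},\ \mathbf{x}_U^* ),$$ where $\mathbf{x}_L^*,\mathbf{x}_U^*\in\mathbb{R}^n$ are the unique solutions of the quadratic programs $$\mathbf{x}_L^*:=\arg\min\ \tfrac12\,\mathbf{x}^T\mathbf{I}\,\mathbf{x}-\mathbf{y}^T\mathbf{x}\quad\text{subject to}\quad \mathbf{a}^T\mathbf{x}=b_l,\quad \mathbf{l}\leqslant\mathbf{x}\leqslant\mathbf{u},$$ $$\mathbf{x}_U^*:=\arg\min\ \tfrac12\,\mathbf{x}^T\mathbf{I}\,\mathbf{x}-\mathbf{y}^T\mathbf{x}\quad\text{subject to}\quad \mathbf{a}^T\mathbf{x}=b_u,\quad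 \mathbf{l}\leqslant\mathbf{x}\leqslant\mathbf{u}.$$
   Context: $\mathbf{I}$ is the $n\times n$ identity matrix. For scalars, the median operator is $\mathtt{mid}(u,v,w)=\max\{u,\min\{v,w\}\}$; for vectors it is applied componentwise, i.e. $\mathtt{mid}(\mathbf{p},\mathbf{v},\mathbf{q})$ is the vector with $i$-th entry $\mathtt{mid}(p_i,v_i,q_i)$. Vector inequalities are componentwise. The solution of the first quadratic program is the Euclidean projection of $\mathbf{y}$ onto $\mathcal{D}_{\mathcal{I}}$.
   Formalization: As mid(u,v,w)=max{u,min{v,w}} fails when a has negative entries, x* is shown to be the true componentwise median of x_L*, y, x_U* for all a, and mid itself for a ≥ 0; x_L*, x_U* exist uniquely only if their programs are feasible, and the formula is claimed when both exist. *)

theory Defs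
  imports "HOL-Analysis.Analysis"
begin

definition qp_obj :: "real ^ 'n \<Rightarrow> real ^ 'n \<Rightarrow> real" where
  "qp_obj y x = 1 / 2 * (x \<bullet> (mat 1 *v x)) - y \<bullet> x"

definition D_ineq :: "real ^ 'n \<Rightarrow> real ^ 'n \<Rightarrow> real ^ 'n \<Rightarrow> real \<Rightarrow> real \<Rightarrow> (real ^ 'n) set" where
  "D_ineq a l u bl bu = {x. l \<le> x \<and> x \<le> u \<and> bl \<le> a \<bullet> x \<and> a \<bullet> x \<le> bu}"

definition D_eq :: "real ^ 'n \<Rightarrow> real ^ 'n \<Rightarrow> real ^ 'n \<Rightarrow> real \<Rightarrow> (real ^ 'n) set" where
  "D_eq a l u b = {x. l \<le> x \<and> x \<le> u \<and> a \<bullet> x = b}"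

abbreviation qp_solution :: "real ^ 'n \<Rightarrow> (real ^ 'n) set \<Rightarrow> real ^ 'n \<Rightarrow> bool" where
  "qp_solution y D x \<equiv> is_arg_min (qp_obj y) (\<lambda>z. z \<in> D) x"

definition mid :: "real \<Rightarrow> real \<Rightarrow> real \<Rightarrow> real" where
  "mid p v q = max p (min v q)"

definition vmid :: "real ^ 'n \<Rightarrow> real ^ 'n \<Rightarrow> real ^ 'n \<Rightarrow> real ^ 'n" where
  "vmid p v q = (\<chi> i. mid (p $ i) (v $ i) (q $ i))"

(* The formula for mid is the median of its three arguments only if p \<le> q. A negative
   entry a$i can make the i-th entries of the two equality-constrained solutions satisfy
   xL$i > xU$i; mid then returns xL$i, which need not be the i-th entry of the solution.
   In dimension 1, with a = -1, l = bl = -1, u = bu = 1 and y = 0, one has xL = 1, xU = -1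
   and mid 1 0 (-1) = 1, whereas the solution is 0, the median of 1, 0, -1. *)
definition median3 :: "real \<Rightarrow> real \<Rightarrow> real \<Rightarrow> real" where
  "median3 p v q = sort [p, v, q] ! 1"

definition vmedian3 :: "real ^ 'n \<Rightarrow> real ^ 'n \<Rightarrow> real ^ 'n \<Rightarrow> real ^ 'n" where
  "vmedian3 p v q = (\<chi> i. median3 (p $ i) (v $ i) (q $ i))"

lemma median3_eq_mid: "p \<le> q \<Longrightarrow> median3 p v q = mid p v q"
  by (auto simp: median3_def mid_def)

lemma vmedian3_eq_vmid: "p \<le> q \<Longrightarrow> vmedian3 p v q = vmid p v q"
  by (simp add: vmedian3_def vmid_def vec_eq_iff less_eq_vec_def median3_eq_mid)

end

theory Submission
  imports Defs
begin

text \<open>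
  Write \<open>\<pi> v = vmid l v u\<close> for the projection of \<open>v\<close> onto the box \<open>[l, u]\<close>, and
  \<open>x(\<theta>) = \<pi> (y + \<theta> a)\<close>. Up to a constant, the objective is half the squared distance to \<open>y\<close>,
  so on a non-empty closed convex set it has exactly one minimiser
  (\<open>qp_solution_ex1\<close>), and a feasible point satisfying the variational inequality is a minimiser
  (\<open>qp_solution_if_variational\<close>). Two facts about the curve \<open>x(\<theta>)\<close> identify the minimisers.

  The box projection satisfies its own variational inequality, so \<open>x(\<theta>)\<close> minimises the objective
  over every subset of the box that contains it and on which \<open>\<theta> (a \<bullet> z) \<ge> \<theta> (a \<bullet> x(\<theta>))\<close>
  (\<open>qp_solution_vmid\<close>). Moreover \<open>a \<bullet> x(\<theta>)\<close> is continuous and non-decreasing in \<open>\<theta>\<close>, and for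
  \<open>\<theta>\<close> of large modulus it attains the extreme values of \<open>a \<bullet> z\<close> on the box. By the intermediate
  value theorem, whenever \<open>a \<bullet> z = b\<close> is feasible there is a multiplier \<open>\<theta>\<close> with
  \<open>a \<bullet> x(\<theta>) = b\<close>, and then \<open>x(\<theta>)\<close> solves the equality-constrained program.

  Thus \<open>xL = x(\<theta>L)\<close> and \<open>xU = x(\<theta>U)\<close>, where \<open>\<theta>L \<le> \<theta>U\<close> can be arranged by monotonicity. With
  \<open>\<mu> = mid \<theta>L 0 \<theta>U\<close>, the point \<open>x(\<mu>)\<close> is feasible for the inequality-constrained program; a
  positive \<open>\<mu>\<close> is \<open>\<theta>L\<close>, where the lower bound is active, and a negative \<open>\<mu>\<close> is \<open>\<theta>U\<close>, where
  the upper bound is active. Hence \<open>x(\<mu>)\<close> is the solution. Finally, the median commutes with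
  monotone maps, and \<open>y + \<mu> a\<close> is the componentwise median of \<open>y + \<theta>L a\<close>, \<open>y\<close>, \<open>y + \<theta>U a\<close>;
  this gives \<open>x(\<mu>)\<close> as the median of \<open>xL\<close>, \<open>y\<close>, \<open>xU\<close> (\<open>median3_mid_line\<close>). If \<open>a \<ge> 0\<close>, then
  \<open>xL \<le> xU\<close>, and the median is given by \<open>mid\<close>.
\<close>

section \<open>Minimising the objective over a closed convex set\<close>

lemma qp_obj_eq_dist: "qp_obj y x = ((dist y x)\<^sup>2 - (norm y)\<^sup>2) / 2"
  by (simp add: qp_obj_def dist_norm power2_norm_eq_inner inner_diff_left inner_diff_right
      inner_commute field_simps)

lemma qp_solution_iff_closest:
  "qp_solution y D x \<longleftrightarrow> x \<in> D \<and> (\<forall>z\<in>D. dist y x \<le> dist y z)"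
proof -
  have "(qp_obj y z < qp_obj y x) \<longleftrightarrow> dist y z < dist y x" for z
    by (simp add: qp_obj_eq_dist divide_less_cancel power2_le_iff_abs_le flip: not_le)
  then show ?thesis
    by (auto simp: is_arg_min_def not_less)
qed

lemma qp_solution_ex1:
  assumes "closed D" "convex D" "D \<noteq> {}"
  shows "\<exists>!x. qp_solution y D x"
proof (rule ex_ex1I)
  show "\<exists>x. qp_solution y D x"
    using closest_point_exists[OF assms(1,3), of y] by (auto simp: qp_solution_iff_closest)
next
  fix x x'
  assume "qp_solution y D x" "qp_solution y D x'"
  then show "x = x'"
    using any_closest_point_unique[OF assms(2,1), of x x' y]
    by (auto simp: qp_solution_iff_closest)
qed

lemma qp_solution_unique:
  assumes "closed D" "convex D" "qp_solution y D x" "qp_solution y D x'"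
  shows "x = x'"
proof -
  have "D \<noteq> {}" using assms(3) by (auto simp: is_arg_min_def)
  then show ?thesis using qp_solution_ex1[of D y] assms by blast
qed

lemma qp_solution_if_variational:
  assumes "x \<in> D" and "\<And>z. z \<in> D \<Longrightarrow> 0 \<le> (x - y) \<bullet> (z - x)"
  shows "qp_solution y D x"
proof -
  have "dist y x \<le> dist y z" if "z \<in> D" for z
  proof -
    have "(dist y z)\<^sup>2 = (dist y x)\<^sup>2 + 2 * ((x - y) \<bullet> (z - x)) + (norm (z - x))\<^sup>2"
      by (simp add: dist_norm power2_norm_eq_inner inner_diff_left inner_diff_right inner_commute)
    then have "(dist y x)\<^sup>2 \<le> (dist y z)\<^sup>2"
      using assms(2)[OF that] by simp
    then show ?thesis by (simp add: power2_le_iff_abs_le)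
  qed
  with assms(1) show ?thesis by (simp add: qp_solution_iff_closest)
qed

lemma box_eq_interval: "{x :: real ^ 'n. l \<le> x \<and> x \<le> u} = cbox l u"
  by (auto simp: less_eq_vec_def mem_box_cart)

lemma D_ineq_eq_Int:
  "D_ineq a l u bl bu = cbox l u \<inter> {x. a \<bullet> x \<ge> bl} \<inter> {x. a \<bullet> x \<le> bu}"
  by (auto simp: D_ineq_def simp flip: box_eq_interval)

lemma D_eq_eq_D_ineq: "D_eq a l u b = D_ineq a l u b b"
  by (auto simp: D_eq_def D_ineq_def)

lemma closed_D_ineq: "closed (D_ineq a l u bl bu)"
  unfolding D_ineq_eq_Int
  by (intro closed_Int closed_cbox closed_halfspace_le closed_halfspace_ge)

lemma convex_D_ineq: "convex (D_ineq a l u bl bu)"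
  unfolding D_ineq_eq_Int
  by (intro convex_Int convex_box convex_halfspace_le convex_halfspace_ge)

section \<open>The projected line\<close>

lemma mid_bounds: "p \<le> q \<Longrightarrow> p \<le> mid p v q \<and> mid p v q \<le> q"
  by (auto simp: mid_def)

lemma mid_mono: "v \<le> w \<Longrightarrow> mid p v q \<le> mid p w q"
  by (auto simp: mid_def)

lemma mid_variational:
  assumes "p \<le> z" "z \<le> q"
  shows "0 \<le> (mid p v q - v) * (z - mid p v q)"
  using assms by (auto simp: mid_def max_def min_def zero_le_mult_iff)

lemma vmid_variational:
  assumes "l \<le> z" "z \<le> u"
  shows "0 \<le> (vmid l v u - v) \<bullet> (z - vmid l v u)"
  unfolding inner_vec_def
  by (rule sum_nonneg) (use assms in \<open>simp add: vmid_def less_eq_vec_def mid_variational\<close>)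

lemma vmid_in_box: "l \<le> u \<Longrightarrow> l \<le> vmid l v u \<and> vmid l v u \<le> u"
  by (simp add: vmid_def less_eq_vec_def mid_bounds)

text \<open>
  Sufficiency of the Karush-Kuhn-Tucker conditions: \<open>\<theta>\<close> is the multiplier of the constraints on
  \<open>a \<bullet> x\<close>, and the sign condition on \<open>\<theta>\<close> is complementary slackness.
\<close>

lemma qp_solution_vmid:
  assumes "D \<subseteq> {z. l \<le> z \<and> z \<le> u}"
    and "vmid l (y + \<theta> *\<^sub>R a) u \<in> D"
    and "\<And>z. z \<in> D \<Longrightarrow> \<theta> * (a \<bullet> vmid l (y + \<theta> *\<^sub>R a) u) \<le> \<theta> * (a \<bullet> z)"
  shows "qp_solution y D (vmid l (y + \<theta> *\<^sub>R a) u)"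
proof (rule qp_solution_if_variational[OF assms(2)])
  fix z assume "z \<in> D"
  define x where "x = vmid l (y + \<theta> *\<^sub>R a) u"
  have "0 \<le> (x - (y + \<theta> *\<^sub>R a)) \<bullet> (z - x)"
    unfolding x_def using assms(1) \<open>z \<in> D\<close> by (intro vmid_variational) auto
  moreover have "\<theta> * (a \<bullet> x) \<le> \<theta> * (a \<bullet> z)"
    unfolding x_def by (rule assms(3)[OF \<open>z \<in> D\<close>])
  ultimately show "0 \<le> (x - y) \<bullet> (z - x)"
    by (simp add: inner_diff_left inner_diff_right inner_add_left algebra_simps)
qed

lemma inner_vmid_line_mono:
  assumes "\<theta> \<le> \<mu>"
  shows "a \<bullet> vmid l (y + \<theta> *\<^sub>R a) u \<le> a \<bullet> vmid l (y + \<mu> *\<^sub>R a) u"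
  unfolding inner_vec_def
proof (rule sum_mono)
  fix i
  show "a $ i \<bullet> vmid l (y + \<theta> *\<^sub>R a) u $ i \<le> a $ i \<bullet> vmid l (y + \<mu> *\<^sub>R a) u $ i"
  proof (cases "0 \<le> a $ i")
    case True
    then show ?thesis
      using assms by (auto simp: vmid_def intro!: mult_left_mono mid_mono mult_right_mono)
  next
    case False
    then show ?thesis
      using assms
      by (auto simp: vmid_def intro!: mult_left_mono_neg mid_mono mult_right_mono_neg)
  qed
qed

lemma continuous_inner_vmid_line:
  "continuous_on S (\<lambda>\<theta>. a \<bullet> vmid l (y + \<theta> *\<^sub>R a) u)"
  unfolding inner_vec_def vmid_def mid_def by (simp add: continuous_intros)

text \<open>
  A single multiplier works for every \<open>i\<close> because there are finitely many components, and in each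
  of them all sufficiently large multipliers work.
\<close>

lemma inner_vmid_line_ge:
  fixes a :: "real ^ 'n"
  assumes "l \<le> z" "z \<le> u"
  shows "\<exists>\<theta>. a \<bullet> z \<le> a \<bullet> vmid l (y + \<theta> *\<^sub>R a) u"
proof -
  have "\<forall>\<^sub>F \<theta> in at_top. a $ i * z $ i \<le> a $ i * vmid l (y + \<theta> *\<^sub>R a) u $ i" for i
  proof -
    have z: "l $ i \<le> z $ i" "z $ i \<le> u $ i"
      using assms by (auto simp: less_eq_vec_def)
    \<comment> \<open>For \<open>a $ i \<noteq> 0\<close>, this is where \<open>y + \<theta> a\<close> passes \<open>z\<close> in the \<open>i\<close>-th component.\<close>
    show ?thesis
      using eventually_ge_at_top[of "(z $ i - y $ i) / a $ i"]
    proof (rule eventually_mono)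
      fix \<theta> assume \<theta>: "(z $ i - y $ i) / a $ i \<le> \<theta>"
      consider "a $ i = 0" | "a $ i > 0" | "a $ i < 0" by linarith
      then show "a $ i * z $ i \<le> a $ i * vmid l (y + \<theta> *\<^sub>R a) u $ i"
      proof cases
        case 2
        then have "z $ i \<le> y $ i + \<theta> * a $ i" using \<theta> by (simp add: field_simps)
        then show ?thesis using 2 z by (auto simp: vmid_def mid_def)
      next
        case 3
        then have "y $ i + \<theta> * a $ i \<le> z $ i" using \<theta> by (simp add: field_simps)
        then show ?thesis using 3 z by (auto simp: vmid_def mid_def)
      qed simp
    qed
  qed
  then have "\<forall>\<^sub>F \<theta> in at_top. \<forall>i. a $ i * z $ i \<le> a $ i * vmid l (y + \<theta> *\<^sub>R a) u $ i"
    by (rule eventually_all_finite)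
  then obtain \<theta> where "\<forall>i. a $ i * z $ i \<le> a $ i * vmid l (y + \<theta> *\<^sub>R a) u $ i"
    using eventually_happens'[OF trivial_limit_at_top_linorder] by blast
  then have "a \<bullet> z \<le> a \<bullet> vmid l (y + \<theta> *\<^sub>R a) u"
    by (auto simp: inner_vec_def intro: sum_mono)
  then show ?thesis ..
qed

lemma multiplier_exists:
  fixes a :: "real ^ 'n"
  assumes "z \<in> D_eq a l u b"
  shows "\<exists>\<theta>. a \<bullet> vmid l (y + \<theta> *\<^sub>R a) u = b"
proof -
  define f where "f \<theta> = a \<bullet> vmid l (y + \<theta> *\<^sub>R a) u" for \<theta>
  have z: "l \<le> z" "z \<le> u" "a \<bullet> z = b" using assms by (auto simp: D_eq_def)
  obtain \<mu> where \<mu>: "b \<le> f \<mu>"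
    using inner_vmid_line_ge[OF z(1,2), of a y] z(3) by (auto simp: f_def)
  \<comment> \<open>The lower bound is the upper bound for \<open>- a\<close>, with the multiplier negated.\<close>
  obtain \<nu> where "- b \<le> - f (- \<nu>)"
    using inner_vmid_line_ge[OF z(1,2), of "- a" y] z(3) by (auto simp: f_def)
  then have \<nu>: "f (- \<nu>) \<le> b" by simp
  have cont: "continuous_on S f" for S
    unfolding f_def by (rule continuous_inner_vmid_line)
  have "\<exists>\<theta>. f \<theta> = b"
  proof (cases "- \<nu> \<le> \<mu>")
    case True
    then show ?thesis using IVT'[OF \<nu> \<mu> _ cont] by blast
  next
    case False
    then have "f \<mu> \<le> f (- \<nu>)" unfolding f_def by (intro inner_vmid_line_mono) simp
    then have "f \<mu> = b" using \<mu> \<nu> by linarith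
    then show ?thesis ..
  qed
  then show ?thesis by (simp add: f_def)
qed

lemma D_eq_solution_eq_vmid:
  assumes "l \<le> u" "qp_solution y (D_eq a l u b) x" "a \<bullet> vmid l (y + \<theta> *\<^sub>R a) u = b"
  shows "x = vmid l (y + \<theta> *\<^sub>R a) u"
proof (rule qp_solution_unique)
  show "closed (D_eq a l u b)" "convex (D_eq a l u b)"
    by (simp_all add: D_eq_eq_D_ineq closed_D_ineq convex_D_ineq)
  show "qp_solution y (D_eq a l u b) x" by fact
  show "qp_solution y (D_eq a l u b) (vmid l (y + \<theta> *\<^sub>R a) u)"
    using assms vmid_in_box[of l u] by (intro qp_solution_vmid) (auto simp: D_eq_def)
qed

section \<open>The inequality-constrained solution as a median\<close>

lemma median3_commute: "median3 p v q = median3 q v p"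
  unfolding median3_def by (cases "p \<le> v"; cases "v \<le> q"; cases "p \<le> q") auto

lemma median3_mid_ordered:
  assumes "p \<le> q" "s \<le> t"
  shows "median3 (mid p (v + s) q) v (mid p (v + t) q) = mid p (v + mid s 0 t) q"
proof -
  have "mid p (v + s) q \<le> mid p (v + t) q"
    using assms(2) by (simp add: mid_mono)
  then have "median3 (mid p (v + s) q) v (mid p (v + t) q) = mid (mid p (v + s) q) v (mid p (v + t) q)"
    by (rule median3_eq_mid)
  also have "\<dots> = mid p (v + mid s 0 t) q"
    using assms unfolding mid_def by linarith
  finally show ?thesis .
qed

text \<open>
  The point \<open>v + mid s 0 t * c\<close> is the median of \<open>v + s c\<close>, \<open>v\<close> and \<open>v + t c\<close>, whatever the sign
  of \<open>c\<close>, and the projection onto \<open>[p, q]\<close> is monotone, so it commutes with the median. On the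
  left, \<open>v\<close> is not projected; this does not change the median, since the other two values lie
  in \<open>[p, q]\<close>.
\<close>

lemma median3_mid_line:
  assumes "p \<le> q" "s \<le> t"
  shows "median3 (mid p (v + s * c) q) v (mid p (v + t * c) q) = mid p (v + mid s 0 t * c) q"
proof -
  consider "0 \<le> c" | "c \<le> 0" by linarith
  then have st: "(s * c \<le> t * c \<and> mid s 0 t * c = mid (s * c) 0 (t * c)) \<or>
      (t * c \<le> s * c \<and> mid s 0 t * c = mid (t * c) 0 (s * c))"
  proof cases
    case 1
    have "s * c \<le> t * c" using 1 assms by (simp add: mult_right_mono)
    moreover have "mid s 0 t * c = mid (s * c) 0 (t * c)"
      using 1 by (simp add: mid_def max_mult_distrib_right min_mult_distrib_right)
    ultimately show ?thesis by blast
  next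
    case 2
    have "t * c \<le> s * c" using 2 assms by (simp add: mult_right_mono_neg)
    moreover have "mid s 0 t * c = mid (t * c) 0 (s * c)"
      using 2 assms
      by (auto simp: mid_def max_def min_def mult_le_0_iff zero_le_mult_iff)
    ultimately show ?thesis by blast
  qed
  then show ?thesis
    using median3_mid_ordered[OF assms(1), of "s * c" "t * c" v]
      median3_mid_ordered[OF assms(1), of "t * c" "s * c" v]
      median3_commute by metis
qed

lemma D_ineq_solution_vmid:
  assumes "l \<le> u" "\<theta>L \<le> \<theta>U"
    and L: "a \<bullet> vmid l (y + \<theta>L *\<^sub>R a) u = bl"
    and U: "a \<bullet> vmid l (y + \<theta>U *\<^sub>R a) u = bu"
  shows "qp_solution y (D_ineq a l u bl bu) (vmid l (y + mid \<theta>L 0 \<theta>U *\<^sub>R a) u)"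
proof -
  define \<mu> where "\<mu> = mid \<theta>L 0 \<theta>U"
  let ?x = "vmid l (y + \<mu> *\<^sub>R a) u"
  have "\<theta>L \<le> \<mu>" "\<mu> \<le> \<theta>U"
    using mid_bounds[OF assms(2)] by (auto simp: \<mu>_def)
  then have bounds: "bl \<le> a \<bullet> ?x" "a \<bullet> ?x \<le> bu"
    using inner_vmid_line_mono[of \<theta>L \<mu> a l y u] inner_vmid_line_mono[of \<mu> \<theta>U a l y u] L U
    by simp_all
  have "qp_solution y (D_ineq a l u bl bu) ?x"
  proof (rule qp_solution_vmid)
    show "D_ineq a l u bl bu \<subseteq> {z. l \<le> z \<and> z \<le> u}" by (auto simp: D_ineq_def)
    show "?x \<in> D_ineq a l u bl bu"
      using bounds vmid_in_box[OF assms(1)] by (simp add: D_ineq_def)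
    fix z assume "z \<in> D_ineq a l u bl bu"
    then have z: "bl \<le> a \<bullet> z" "a \<bullet> z \<le> bu" by (auto simp: D_ineq_def)
    consider "\<mu> = 0" | "\<mu> > 0" "\<mu> = \<theta>L" | "\<mu> < 0" "\<mu> = \<theta>U"
      using assms(2) unfolding \<mu>_def mid_def by linarith
    then show "\<mu> * (a \<bullet> ?x) \<le> \<mu> * (a \<bullet> z)"
    proof cases
      case 2
      then show ?thesis using L z by simp
    next
      case 3
      then show ?thesis using U z by simp
    qed simp
  qed
  then show ?thesis by (simp add: \<mu>_def)
qed

theorem theorem2p7:
  fixes a l u y :: "real ^ 'n" and bl bu :: real
  assumes "l \<le> u"
    and "D_ineq a l u bl bu \<noteq> {}"
  shows "(\<exists>!xs. qp_solution y (D_ineq a l u bl bu) xs) \<and>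
    (D_eq a l u bl \<noteq> {} \<longrightarrow> (\<exists>!xL. qp_solution y (D_eq a l u bl) xL)) \<and>
    (D_eq a l u bu \<noteq> {} \<longrightarrow> (\<exists>!xU. qp_solution y (D_eq a l u bu) xU)) \<and>
    (\<forall>xs xL xU. qp_solution y (D_ineq a l u bl bu) xs \<longrightarrow>
       qp_solution y (D_eq a l u bl) xL \<longrightarrow> qp_solution y (D_eq a l u bu) xU \<longrightarrow>
       xs = vmedian3 xL y xU \<and> (0 \<le> a \<longrightarrow> xs = vmid xL y xU))"
proof (intro conjI impI allI)
  show "\<exists>!xs. qp_solution y (D_ineq a l u bl bu) xs"
    by (intro qp_solution_ex1 closed_D_ineq convex_D_ineq assms)
  show "\<exists>!xL. qp_solution y (D_eq a l u bl) xL" if "D_eq a l u bl \<noteq> {}"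
    using that unfolding D_eq_eq_D_ineq
    by (intro qp_solution_ex1 closed_D_ineq convex_D_ineq)
  show "\<exists>!xU. qp_solution y (D_eq a l u bu) xU" if "D_eq a l u bu \<noteq> {}"
    using that unfolding D_eq_eq_D_ineq
    by (intro qp_solution_ex1 closed_D_ineq convex_D_ineq)
next
  fix xs xL xU
  assume xs: "qp_solution y (D_ineq a l u bl bu) xs"
    and xL: "qp_solution y (D_eq a l u bl) xL" and xU: "qp_solution y (D_eq a l u bu) xU"
  have b: "bl \<le> bu" using assms(2) by (auto simp: D_ineq_def)
  define f where "f \<theta> = a \<bullet> vmid l (y + \<theta> *\<^sub>R a) u" for \<theta>
  obtain \<theta> \<mu> where "f \<theta> = bl" "f \<mu> = bu"
    using multiplier_exists[of xL a l u bl y] multiplier_exists[of xU a l u bu y] xL xU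
    by (auto simp: is_arg_min_def f_def)
  \<comment> \<open>Multipliers in the wrong order force \<open>bl = bu\<close>, and may then be swapped.\<close>
  moreover have "bl = bu" if "\<mu> \<le> \<theta>"
    using inner_vmid_line_mono[OF that, of a l y u] b calculation by (simp add: f_def)
  ultimately obtain \<theta>L \<theta>U where le: "\<theta>L \<le> \<theta>U" and LU: "f \<theta>L = bl" "f \<theta>U = bu"
    using linear[of \<theta> \<mu>] by metis
  have xL_eq: "xL = vmid l (y + \<theta>L *\<^sub>R a) u" and xU_eq: "xU = vmid l (y + \<theta>U *\<^sub>R a) u"
    using D_eq_solution_eq_vmid[OF assms(1) xL] D_eq_solution_eq_vmid[OF assms(1) xU] LU
    by (simp_all add: f_def)
  have "xs = vmid l (y + mid \<theta>L 0 \<theta>U *\<^sub>R a) u"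
    using qp_solution_unique[OF closed_D_ineq convex_D_ineq xs]
      D_ineq_solution_vmid[OF assms(1) le] LU by (simp add: f_def)
  also have "\<dots> = vmedian3 xL y xU"
    using assms(1) le unfolding xL_eq xU_eq
    by (simp add: vec_eq_iff vmedian3_def vmid_def less_eq_vec_def median3_mid_line)
  finally show xs_eq: "xs = vmedian3 xL y xU" .
  show "xs = vmid xL y xU" if "0 \<le> a"
  proof -
    have "xL \<le> xU"
      using that le unfolding xL_eq xU_eq
      by (auto simp: vmid_def less_eq_vec_def intro!: mid_mono mult_right_mono)
    then show ?thesis using xs_eq by (simp add: vmedian3_eq_vmid)
  qed
qed

end
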